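(* (Saturation principle in ${}^*\mathcal{E}(\mathbb{R}^d)$.) Let $\{\mathcal{F}_n\}_{n=0}^\infty$ be a sequence of internal sets in ${}^*\mathcal{E}(\mathbb{R}^d)$ such that $\bigcap_{n=0}^m\mathcal{F}_n\neq\varnothing$ for all $m\in\mathbb{N}$. Then $\bigcap_{n=0}^\infty\mathcal{F}_n\neq\varnothing$.
   Context: Let $d\ge 1$, $\mathcal{E}(\mathbb{R}^d)=\mathcal{C}^\infty(\mathbb{R}^d)$ (smooth complex-valued functions) and $\mathcal{D}(\mathbb{R}^d)=\mathcal{C}_0^\infty(\mathbb{R}^d)$ (those with compact support). Put $\mathcal{B}_0=\mathcal{D}(\mathbb{R}^d)$ and, for $n\in\mathbb{N}=\{1,2,\dots\}$, let $\mathcal{B}_n$ be the set of all $\varphi\in\mathcal{D}(\mathbb{R}^d)$ such that: $\varphi$ is real-valued and symmetric ($\varphi(-x)=\varphi(x)$); $\varphi(x)=0$ whenever $\|x\|\ge 1/n$; $\int\varphi=1$; $\int x^\alpha\varphi(x)\,dx=0$ for all multi-indices $\alpha\in\mathbb{N}_0^d$ with $1\le|\alpha|\le n$; and $1\le\int|\varphi|<1+\frac1n$. It is known that each $\mathcal{B}_n$ is non-empty, that $\mathcal{B}_0\supset\mathcal{B}_1\supset\mathcal{B}_2\supset\cdots$, and that $\bigcap_n\mathcal{B}_n=\varnothing$. Fix an ultrafilter $\mathcal{U}$ on the set $\mathcal{D}(\mathbb{R}^d)$ containing the filter $\{\Phi\subseteq\mathcal{D}(\mathbb{R}^d): \mathcal{B}_n\subseteq\Phi\text{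 for some }n\in\mathbb{N}\}$. A property holds "a.e." if the set of $\varphi$ for which it holds belongs to $\mathcal{U}$. ${}^*\mathcal{E}(\mathbb{R}^d)$ is the set of equivalence classes $\langle f_\varphi\rangle$ of families $(f_\varphi)\in\mathcal{E}(\mathbb{R}^d)^{\mathcal{D}(\mathbb{R}^d)}$ under the relation $(f_\varphi)\sim(g_\varphi)$ iff $f_\varphi=g_\varphi$ a.e. A subset of ${}^*\mathcal{E}(\mathbb{R}^d)$ is internal if it is of the form $\langle\mathbb{F}_\varphi\rangle=\{\langle f_\varphi\rangle\in{}^*\mathcal{E}(\mathbb{R}^d): f_\varphi\in\mathbb{F}_\varphi\text{ a.e.}\}$ for some family $(\mathbb{F}_\varphi)_{\varphi\in\mathcal{D}(\mathbb{R}^d)}$ of subsets of $\mathcal{E}(\mathbb{R}^d)$. *)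

theory Defs
  imports "HOL-Analysis.Analysis"
begin

definition partial_deriv :: "'n::finite \<Rightarrow> (real ^ 'n \<Rightarrow> complex) \<Rightarrow> real ^ 'n \<Rightarrow> complex" where
  "partial_deriv i f = (\<lambda>x. frechet_derivative f (at x) (axis i 1))"

primrec C_class :: "nat \<Rightarrow> (real ^ 'n::finite \<Rightarrow> complex) \<Rightarrow> bool" where
  "C_class 0 f \<longleftrightarrow> continuous_on UNIV f"
| "C_class (Suc k) f \<longleftrightarrow>
     (\<forall>x. f differentiable (at x)) \<and> (\<forall>i. C_class k (partial_deriv i f))"

definition smooth_funs :: "(real ^ 'n::finite \<Rightarrow> complex) set" where
  "smooth_funs = {f. \<forall>k. C_class k f}"

definition test_funs :: "(real ^ 'n::finite \<Rightarrow> complex) set" where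
  "test_funs = {f \<in> smooth_funs. compact (closure {x. f x \<noteq> 0})}"

definition monomial :: "('n::finite \<Rightarrow> nat) \<Rightarrow> real ^ 'n \<Rightarrow> real" where
  "monomial \<alpha> x = (\<Prod>i\<in>UNIV. (x $ i) ^ \<alpha> i)"

definition mollifiers :: "nat \<Rightarrow> (real ^ 'n::finite \<Rightarrow> complex) set" where
  "mollifiers n =
     (if n = 0 then test_funs
      else {\<phi> \<in> test_funs.
        (\<forall>x. \<phi> x \<in> \<real>) \<and>
        (\<forall>x. \<phi> (- x) = \<phi> x) \<and>
        (\<forall>x. norm x \<ge> 1 / real n \<longrightarrow> \<phi> x = 0) \<and>
        (LINT x|lborel. \<phi> x) = 1 \<and>
        (\<forall>\<alpha>. 1 \<le> (\<Sum>i\<in>UNIV. \<alpha> i) \<and> (\<Sum>i\<in>UNIV. \<alpha> i) \<le> n \<longrightarrow>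
           (LINT x|lborel. of_real (monomial \<alpha> x) * \<phi> x) = 0) \<and>
        1 \<le> (LINT x|lborel. norm (\<phi> x)) \<and>
        (LINT x|lborel. norm (\<phi> x)) < 1 + 1 / real n})"

text \<open>A filter on the set \<open>X\<close> is a filter on the ambient type that contains \<open>X\<close>;
  a property holds almost everywhere iff it holds \<^const>\<open>eventually\<close> along it.\<close>

definition ultrafilter_on :: "'a set \<Rightarrow> 'a filter \<Rightarrow> bool" where
  "ultrafilter_on X U \<longleftrightarrow>
     U \<le> principal X \<and> U \<noteq> bot \<and>
     (\<forall>P. eventually P U \<or> eventually (\<lambda>x. \<not> P x) U)"

definition mollifier_ultrafilter :: "(real ^ 'n::finite \<Rightarrow> complex) filter \<Rightarrow> bool" where
  "mollifier_ultrafilter U \<longleftrightarrow>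
     ultrafilter_on test_funs U \<and>
     (\<forall>\<Phi>. \<Phi> \<subseteq> test_funs \<and> (\<exists>n\<ge>1. mollifiers n \<subseteq> \<Phi>) \<longrightarrow> (\<forall>\<^sub>F \<phi> in U. \<phi> \<in> \<Phi>))"

type_synonym 'n family = "(real ^ 'n \<Rightarrow> complex) \<Rightarrow> (real ^ 'n \<Rightarrow> complex)"

definition families :: "'n::finite family set" where
  "families = test_funs \<rightarrow>\<^sub>E smooth_funs"

definition ae_rel :: "(real ^ 'n::finite \<Rightarrow> complex) filter \<Rightarrow> ('n family \<times> 'n family) set" where
  "ae_rel U = {(f, g). f \<in> families \<and> g \<in> families \<and> (\<forall>\<^sub>F \<phi> in U. f \<phi> = g \<phi>)}"

definition star_E :: "(real ^ 'n::finite \<Rightarrow> complex) filter \<Rightarrow> 'n family set set" where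
  "star_E U = families // ae_rel U"

definition star_class ::
    "(real ^ 'n::finite \<Rightarrow> complex) filter \<Rightarrow> 'n family \<Rightarrow> 'n family set" where
  "star_class U f = ae_rel U `` {f}"

definition internal_of ::
    "(real ^ 'n::finite \<Rightarrow> complex) filter
       \<Rightarrow> ((real ^ 'n \<Rightarrow> complex) \<Rightarrow> (real ^ 'n \<Rightarrow> complex) set) \<Rightarrow> 'n family set set" where
  "internal_of U F =
     {star_class U f | f. f \<in> families \<and> (\<forall>\<^sub>F \<phi> in U. f \<phi> \<in> F \<phi>)}"

definition internal ::
    "(real ^ 'n::finite \<Rightarrow> complex) filter \<Rightarrow> 'n family set set \<Rightarrow> bool" where
  "internal U A \<longleftrightarrow>
     (\<exists>F. (\<forall>\<phi>\<in>test_funs. F \<phi> \<subseteq> smooth_funs) \<and> A = internal_of U F)"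

lemma equiv_ae_rel: "equiv families (ae_rel U)"
proof (rule equivI)
  show "sym (ae_rel U)"
    unfolding sym_def ae_rel_def by (auto elim: eventually_mono)
  show "trans (ae_rel U)"
    unfolding trans_def ae_rel_def by (auto elim: eventually_elim2)
qed (auto simp: refl_on_def ae_rel_def)

lemma internal_subset_star_E: "internal U A \<Longrightarrow> A \<subseteq> star_E U"
  by (auto simp: internal_def internal_of_def star_E_def star_class_def intro: quotientI)

lemma star_class_in_internal_of_iff:
  assumes "f \<in> families"
  shows "star_class U f \<in> internal_of U F \<longleftrightarrow> (\<forall>\<^sub>F \<phi> in U. f \<phi> \<in> F \<phi>)"
proof
  assume "star_class U f \<in> internal_of U F"
  then obtain g where g: "g \<in> families" "\<forall>\<^sub>F \<phi> in U. g \<phi> \<in> F \<phi>"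
    and "ae_rel U `` {f} = ae_rel U `` {g}"
    by (auto simp: internal_of_def star_class_def)
  then have "(f, g) \<in> ae_rel U"
    using assms eq_equiv_class[OF _ equiv_ae_rel] by blast
  then have "\<forall>\<^sub>F \<phi> in U. f \<phi> = g \<phi>"
    by (simp add: ae_rel_def)
  with g(2) show "\<forall>\<^sub>F \<phi> in U. f \<phi> \<in> F \<phi>"
    by (auto elim: eventually_elim2)
qed (use assms in \<open>auto simp: internal_of_def\<close>)

end

theory Submission
  imports Defs
begin

text \<open>
  The ultrafilter is countably incomplete: it contains every \<^term>\<open>mollifiers n\<close> with \<open>n \<ge> 1\<close>,
  and these sets have empty intersection, because a function whose support shrinks to the origin
  vanishes almost everywhere and cannot have integral one. This is what makes the usual
  diagonal construction work. Represent the \<open>n\<close>-th internal set by a family \<open>G n \<phi>\<close> of sets.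
  A common point of the first \<open>m + 1\<close> internal sets shows that, for almost every \<open>\<phi>\<close>, the sets
  \<open>G 0 \<phi>, \<dots>, G m \<phi>\<close> have a common element. For an individual \<open>\<phi>\<close> one may have a
  common element for every \<open>m\<close> without having one for all \<open>m\<close> at once. Countable
  incompleteness is the remedy: requiring also that \<open>\<phi>\<close> belongs to the first mollifier classes
  makes the condition fail at some finite stage, so that there is a last stage at which
  it holds, and a common element taken at that last stage serves all stages reached before. For
  each fixed \<open>n\<close>, stage \<open>n\<close> is reached by almost every \<open>\<phi>\<close>; hence the chosen functions
  represent a point of every internal set.
\<close>

text \<open>
  The diagonal argument for an arbitrary filter: the sets \<open>B k\<close> only serve to cap, at each \<open>x\<close>,
  the number of conditions that have to be met simultaneously.
\<close>

lemma countably_incomplete_saturation: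
  fixes V :: "'a filter" and R :: "nat \<Rightarrow> 'a \<Rightarrow> 'b \<Rightarrow> bool" and B :: "nat \<Rightarrow> 'a set"
  assumes B: "\<And>k. \<forall>\<^sub>F x in V. x \<in> B k"
    and empty: "(\<Inter>k. B k) = {}"
    and fip: "\<And>m. \<forall>\<^sub>F x in V. \<exists>h. \<forall>n\<le>m. R n x h"
  shows "\<exists>f. \<forall>n. \<forall>\<^sub>F x in V. R n x (f x)"
proof -
  define Q where "Q m x \<longleftrightarrow> (\<exists>h. \<forall>n\<le>m. R n x h) \<and> (\<forall>k\<le>m. x \<in> B k)" for m x
  have Q_antimono: "Q k x" if "Q m x" "k \<le> m" for k m x
    using that by (auto simp: Q_def intro: order_trans)
  have Q_fails: "\<exists>m. \<not> Q m x" for x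
  proof -
    obtain k where "x \<notin> B k"
      using empty by blast
    then have "\<not> Q k x"
      by (auto simp: Q_def)
    then show ?thesis ..
  qed
  define L where "L x = (LEAST m. \<not> Q m x)" for x
  \<comment> \<open>\<open>L x - 1\<close> is the last stage reached at \<open>x\<close>. If not even stage \<open>0\<close> is reached, the choice
    below is arbitrary; this happens only on a negligible set.\<close>
  define f where "f x = (SOME h. \<forall>n\<le>L x - 1. R n x h)" for x
  have f: "R n x (f x)" if "Q n x" for n x
  proof -
    have "\<not> Q (L x) x"
      unfolding L_def using Q_fails by (rule LeastI_ex)
    with Q_antimono[OF that] have "n < L x"
      by (meson not_less)
    then have "Q (L x - 1) x"
      using not_less_Least[of "L x - 1" "\<lambda>m. \<not> Q m x"] by (simp add: L_def)
    then have "\<exists>h. \<forall>n\<le>L x - 1. R n x h"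
      by (simp add: Q_def)
    then have "\<forall>n\<le>L x - 1. R n x (f x)"
      unfolding f_def by (rule someI_ex)
    with \<open>n < L x\<close> show ?thesis
      by simp
  qed
  have "\<forall>\<^sub>F x in V. Q n x" for n
  proof -
    have "\<forall>\<^sub>F x in V. \<forall>k\<in>{..n}. x \<in> B k"
      using B by (intro eventually_ball_finite) auto
    with fip[of n] show ?thesis
      by eventually_elim (simp add: Q_def)
  qed
  then have "\<forall>\<^sub>F x in V. R n x (f x)" for n
    by (rule eventually_mono) (rule f)
  then show ?thesis
    by blast
qed

text \<open>
  A common element would vanish off the origin, hence Lebesgue-almost everywhere, against the
  normalisation of its integral.
\<close>

lemma Inter_mollifiers_Suc_empty:
  "(\<Inter>k. mollifiers (Suc k)) = ({} :: (real ^ 'n::finite \<Rightarrow> complex) set)"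
proof (rule equals0I)
  fix \<phi> :: "real ^ 'n \<Rightarrow> complex"
  assume "\<phi> \<in> (\<Inter>k. mollifiers (Suc k))"
  then have \<phi>: "\<phi> \<in> mollifiers (Suc k)" for k
    by blast
  have zero: "\<phi> x = 0" if "x \<noteq> 0" for x
  proof -
    obtain k where "1 / real (Suc k) < norm x"
      using nat_approx_posE[of "norm x"] \<open>x \<noteq> 0\<close> by auto
    with \<phi>[of k] show ?thesis
      by (auto simp: mollifiers_def)
  qed
  have "AE x in lborel. \<phi> x = 0"
    using AE_lborel_singleton[of 0] by eventually_elim (rule zero)
  then have "(LINT x|lborel. \<phi> x) = 0"
    by (rule integral_eq_zero_AE)
  moreover have "(LINT x|lborel. \<phi> x) = 1"
    using \<phi>[of 0] by (simp add: mollifiers_def)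
  ultimately show False
    by simp
qed

lemma eventually_mollifiers_Suc:
  assumes "mollifier_ultrafilter U"
  shows "\<forall>\<^sub>F \<phi> in U. \<phi> \<in> mollifiers (Suc k)"
proof -
  have "mollifiers (Suc k) \<subseteq> test_funs"
    by (auto simp: mollifiers_def)
  moreover have "\<exists>n\<ge>1. mollifiers n \<subseteq> mollifiers (Suc k)"
    by (intro exI[of _ "Suc k"]) simp
  ultimately show ?thesis
    using assms unfolding mollifier_ultrafilter_def by blast
qed

theorem theorem9p1:
  fixes U :: "(real ^ 'n::finite \<Rightarrow> complex) filter"
    and F :: "nat \<Rightarrow> 'n family set set"
  assumes "mollifier_ultrafilter U"
    and "\<And>n. internal U (F n)"
    and "\<And>m. m \<ge> 1 \<Longrightarrow> (\<Inter>n\<in>{0..m}. F n) \<noteq> {}"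
  shows "(\<Inter>n. F n) \<noteq> {}"
proof -
  obtain G where G: "\<And>n \<phi>. \<phi> \<in> test_funs \<Longrightarrow> G n \<phi> \<subseteq> smooth_funs"
    and F: "\<And>n. F n = internal_of U (G n)"
    using assms(2) unfolding internal_def by metis
  have common: "\<exists>g\<in>families. \<forall>n\<le>m. \<forall>\<^sub>F \<phi> in U. g \<phi> \<in> G n \<phi>" for m
  proof -
    \<comment> \<open>The hypothesis speaks of \<open>m \<ge> 1\<close>; one extra set covers the case \<open>m = 0\<close>.\<close>
    obtain c where c: "\<And>n. n \<le> Suc m \<Longrightarrow> c \<in> F n"
    proof -
      obtain c where "c \<in> (\<Inter>n\<in>{0..Suc m}. F n)"
        using assms(3)[of "Suc m"] by (metis Suc_le_mono One_nat_def le0 ex_in_conv)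
      then have "c \<in> F n" if "n \<le> Suc m" for n
        using that by (meson INT_D atLeastAtMost_iff le0)
      then show thesis
        by (rule that)
    qed
    from c[of 0] obtain g where g: "g \<in> families" "c = star_class U g"
      by (auto simp: F internal_of_def)
    have "\<forall>\<^sub>F \<phi> in U. g \<phi> \<in> G n \<phi>" if "n \<le> m" for n
      using c[of n] that g by (simp add: F star_class_in_internal_of_iff)
    with g(1) show ?thesis
      by blast
  qed
  have "\<forall>\<^sub>F \<phi> in U. \<exists>h. \<forall>n\<le>m. h \<in> G n \<phi>" for m
  proof -
    obtain g where "\<forall>n\<le>m. \<forall>\<^sub>F \<phi> in U. g \<phi> \<in> G n \<phi>"
      using common by blast
    then have "\<forall>\<^sub>F \<phi> in U. \<forall>n\<in>{..m}. g \<phi> \<in> G n \<phi>"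
      by (intro eventually_ball_finite) auto
    then show ?thesis
      by (rule eventually_mono) auto
  qed
  then obtain f where f: "\<forall>\<^sub>F \<phi> in U. f \<phi> \<in> G n \<phi>" for n
    using countably_incomplete_saturation[OF eventually_mollifiers_Suc[OF assms(1)]
        Inter_mollifiers_Suc_empty, of "\<lambda>n \<phi> h. h \<in> G n \<phi>"]
    by blast
  \<comment> \<open>The chosen \<open>f \<phi>\<close> may fail to be smooth on a negligible set of \<open>\<phi>\<close>; there it is replaced
    by an actual family, so that the result represents an element of \<open>star_E U\<close>.\<close>
  obtain g :: "'n family" where g: "g \<in> families"
    using common[of 0] by blast
  define f' where
    "f' = restrict (\<lambda>\<phi>. if f \<phi> \<in> smooth_funs then f \<phi> else g \<phi>) test_funs"
  have f': "f' \<in> families"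
    using g by (auto simp: families_def f'_def PiE_iff)
  have test: "\<forall>\<^sub>F \<phi> in U. \<phi> \<in> test_funs"
    using eventually_mollifiers_Suc[OF assms(1), of 0]
    by (rule eventually_mono) (simp add: mollifiers_def)
  have "\<forall>\<^sub>F \<phi> in U. f' \<phi> \<in> G n \<phi>" for n
    using f[of n] test
  proof eventually_elim
    case (elim \<phi>)
    with G[of \<phi> n] show ?case
      by (auto simp: f'_def)
  qed
  then have "star_class U f' \<in> F n" for n
    using f' by (simp add: F star_class_in_internal_of_iff)
  then show ?thesis
    by blast
qed

end
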